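(* Let $A$ be an algebra and $H$ a Hopf algebra, equipped with actions $\alpha_t$ on $A$ and $\beta_t$ on $H$ of the $n$-torus $\mathbb{T}^n$, and let $\theta,\theta'$ be real skew-symmetric $n\times n$ matrices defining the deformed algebras $A_\theta$ and $H_{\theta'}$. A coaction $\rho:A\to H\otimes A$ of $H$ on $A$ extends to a coaction $\rho_\theta:A_\theta\to H_{\theta'}\otimes A_\theta$ if for all $a=\sum_{\vec n}a_{\vec n}$ and $b=\sum_{\vec m}b_{\vec m}$ in $A$ (isotypic decompositions) the following holds for all $\vec n,\vec m\in\mathbb{Z}^n$: $$ e^{\pi i\theta(\vec n,\vec m)}\int_{\mathbb{T}^n\times\mathbb{T}^n}\rho(\alpha_t(a_{\vec n}))\,\rho(\alpha_s(b_{\vec m}))\,e^{-2\pi i(t\cdot\vec n+s\cdot\vec m)}\,dt\,ds $$ $$ =\sum_{(\vec n',\vec p),(\vec m',\vec q)}e^{\pi i(\theta'(\vec n',\vec m')+\theta(\vec p,\vec q))}\int_{\mathbb{T}^{2n}\times\mathbb{T}^{2n}}(\beta_{t'}\otimes\alpha_t)(\rho(a_{\vec n}))\,(\beta_{s'}\otimes\alpha_s)(\rho(b_{\vec m}))\,e^{-2\pi i(t'\cdot\vec n'+t\cdot\vec p+s'\cdot\vec m'+s\cdot\vec q)}\,dt'\,dt\,ds'\,ds , $$ where the sum runs over $(\vec n',\vec p),(\vec m',\vec q)\in\mathbb{Z}^n\times\mathbb{Z}^n$ and all products are the undeformed products of $H\otimes A$. Moreover, the algebra of coinvariant elements $A_\theta^{\mathrm{co}H_{\theta'}}\subset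 A_\theta$ consists of the same elements as $A^{\mathrm{co}H}$.
   Context: **Isotypic components.** For an algebra $A$ with a $\mathbb{T}^n$-action $\alpha$ by automorphisms, $\mathbb{T}^n=\mathbb{R}^n/\mathbb{Z}^n$ with normalized Haar measure, the isotypic component of $a\in A$ of degree $\vec n\in\mathbb{Z}^n$ is $a_{\vec n}=\int_{\mathbb{T}^n}\alpha_t(a)e^{-2\pi i t\cdot\vec n}\,dt$, so that $\alpha_t(a_{\vec n})=e^{2\pi i t\cdot\vec n}a_{\vec n}$. It is assumed, as in the paper, that these integrals make sense and that elements decompose as $a=\sum_{\vec n}a_{\vec n}$ (for a $C^*$-algebra this is done on the subalgebra of smooth elements for the action, which is unchanged as a vector space by the deformation). The same applies to $H$ with $\beta$. **Deformed algebras.** For a real skew-symmetric $n\times n$ matrix $\theta$ write $\theta(\vec n,\vec m)=\vec n\cdot\theta\vec m$. $A_\theta$ is the vector space $A$ with the product $a\times_\theta b=\sum_{\vec n,\vec m}e^{\pi i\theta(\vec n,\vec m)}a_{\vec n}b_{\vec m}$. $H_{\theta'}$ is defined in the same way from $\beta$ and $\theta'$; its coproduct $\Delta$ and counit $\epsilon$ are those of $H$, and $\theta'$ is assumed to be such that $H_{\theta'}$ with this unaltered coalgebra structure is a Hopf algebra. The algebra $H_{\theta'}\otimes A_\theta$ is the deformation of $H\otimes A$ with respect to the action $\beta_{t'}\otimes\alpha_t$ of $\mathbb{T}^n\times\mathbb{T}^n$ and the matrix $\theta'\oplus\theta$. **Coactions.** A (left) coaction of $H$ on $A$ is an algebra map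 $\rho:A\to H\otimes A$ with $(\Delta\otimes\mathrm{id})\circ\rho=(\mathrm{id}\otimes\rho)\circ\rho$ and $(\epsilon\otimes\mathrm{id})\circ\rho=\mathrm{id}$. Its coinvariants are $A^{\mathrm{co}H}=\{a\in A:\rho(a)=1\otimes a\}$. "$\rho$ extends to a coaction $\rho_\theta$" means that the same linear map $\rho$, viewed on the underlying vector space of $A_\theta$, is a coaction $A_\theta\to H_{\theta'}\otimes A_\theta$ for the deformed products. *)

theory Defs
  imports "HOL-Analysis.Analysis"
begin

text \<open>
  Integrals over the torus and infinite isotypic decompositions need a topology, so algebras are
  topological algebras.  Purely algebraic data (algebraic tensor products, finite isotypic
  decompositions) are the special case in which every space carries its finest locally convex
  topology: then every linear map is continuous, every separately linear map is separately
  continuous, every subspace is closed, and an unconditionally convergent decomposition into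
  isotypic components has only finitely many nonzero terms.
\<close>

class scaleC =
  fixes scaleC :: "complex \<Rightarrow> 'a \<Rightarrow> 'a"  (infixr \<open>*\<^sub>C\<close> 75)

text \<open>
  Complex topological vector spaces whose continuous dual separates the points (e.g. all Hausdorff
  locally convex spaces).  Separation of points is what makes weak integrals unique; it implies the
  Hausdorff property, which is listed only because sums are defined for that type class.
\<close>

class complex_tvs = scaleC + topological_ab_group_add + t2_space +
  assumes scaleC_add_right: "c *\<^sub>C (x + y) = c *\<^sub>C x + c *\<^sub>C y"
    and scaleC_add_left: "(c + d) *\<^sub>C x = c *\<^sub>C x + d *\<^sub>C x"
    and scaleC_scaleC: "c *\<^sub>C d *\<^sub>C x = (c * d) *\<^sub>C x"
    and scaleC_one: "1 *\<^sub>C x = x"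
    and continuous_scaleC: "((\<lambda>p. fst p *\<^sub>C snd p) \<longlongrightarrow> c *\<^sub>C x) (nhds c \<times>\<^sub>F nhds x)"
    and dual_separates: "x \<noteq> 0 \<Longrightarrow> \<exists>\<phi>. (\<forall>y z. \<phi> (y + z) = \<phi> y + \<phi> z) \<and>
          (\<forall>c y. \<phi> (c *\<^sub>C y) = c * \<phi> y) \<and> (\<forall>y. (\<phi> \<longlongrightarrow> \<phi> y) (nhds y)) \<and> \<phi> x \<noteq> 0"

text \<open>Multiplication is only required to be separately continuous.\<close>

class complex_talgebra_1 = complex_tvs + ring_1 +
  assumes scaleC_mult_left: "(c *\<^sub>C x) * y = c *\<^sub>C (x * y)"
    and scaleC_mult_right: "x * (c *\<^sub>C y) = c *\<^sub>C (x * y)"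
    and continuous_mult_left: "((\<lambda>x. x * y) \<longlongrightarrow> x * y) (nhds x)"
    and continuous_mult_right: "((\<lambda>y. x * y) \<longlongrightarrow> x * y) (nhds y)"

instantiation complex :: complex_talgebra_1
begin

definition scaleC_complex :: "complex \<Rightarrow> complex \<Rightarrow> complex"
  where "scaleC_complex c x = c * x"

instance
proof
  fix x :: complex
  assume "x \<noteq> 0"
  then show "\<exists>\<phi>. (\<forall>y z. \<phi> (y + z) = \<phi> y + \<phi> z) \<and> (\<forall>c y. \<phi> (c *\<^sub>C y) = c * \<phi> y) \<and>
      (\<forall>y. (\<phi> \<longlongrightarrow> \<phi> y) (nhds y)) \<and> \<phi> x \<noteq> 0"
    by (intro exI[of _ "\<lambda>x. x"]) (auto simp: scaleC_complex_def filterlim_ident)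
qed (auto simp: scaleC_complex_def algebra_simps
       intro!: tendsto_mult[OF filterlim_fst filterlim_snd] tendsto_intros filterlim_ident)

end

definition cont_linear :: "('a::complex_tvs \<Rightarrow> 'b::complex_tvs) \<Rightarrow> bool"
  where "cont_linear f \<longleftrightarrow> (\<forall>x y. f (x + y) = f x + f y) \<and> (\<forall>c x. f (c *\<^sub>C x) = c *\<^sub>C f x) \<and>
    continuous_on UNIV f"

definition cont_bilinear :: "('a::complex_tvs \<Rightarrow> 'b::complex_tvs \<Rightarrow> 'c::complex_tvs) \<Rightarrow> bool"
  where "cont_bilinear B \<longleftrightarrow> (\<forall>x. cont_linear (B x)) \<and> (\<forall>y. cont_linear (\<lambda>x. B x y))"


section \<open>Tensor products\<close>

text \<open>
  \<open>tensor_product T\<close>: the target of \<open>T\<close> is a (possibly completed) tensor product with pure tensors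
  \<open>T x y\<close>.  The first clause after bilinearity says that the linear map from the algebraic tensor
  product induced by \<open>T\<close> is injective, the second that its range is dense.
\<close>

definition tensor_product :: "('x::complex_tvs \<Rightarrow> 'y::complex_tvs \<Rightarrow> 'z::complex_tvs) \<Rightarrow> bool"
  where "tensor_product T \<longleftrightarrow> cont_bilinear T \<and>
    (\<forall>B u. finite B \<and> \<not> module.dependent scaleC B \<and> (\<Sum>y\<in>B. T (u y) y) = 0 \<longrightarrow> (\<forall>y\<in>B. u y = 0)) \<and>
    closure (module.span scaleC (range (\<lambda>(x, y). T x y))) = UNIV"

definition tensor_algebra ::
    "('x::complex_talgebra_1 \<Rightarrow> 'y::complex_talgebra_1 \<Rightarrow> 'z::complex_talgebra_1) \<Rightarrow> bool"
  where "tensor_algebra T \<longleftrightarrow> tensor_product T \<and> 1 = T 1 1 \<and>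
    (\<forall>x y x' y'. T x y * T x' y' = T (x * x') (y * y'))"

text \<open>
  The threefold tensor product \<open>X \<otimes> Y \<otimes> Z\<close>, given both as \<open>(X \<otimes> Y) \<otimes> Z\<close> (via \<open>Tl\<close>) and as
  \<open>X \<otimes> (Y \<otimes> Z)\<close> (via \<open>Tr\<close>).
\<close>

definition triple_tensor_product ::
    "('x::complex_tvs \<Rightarrow> 'y::complex_tvs \<Rightarrow> 'xy::complex_tvs) \<Rightarrow> ('y \<Rightarrow> 'z::complex_tvs \<Rightarrow> 'yz::complex_tvs)
      \<Rightarrow> ('xy \<Rightarrow> 'z \<Rightarrow> 'xyz::complex_tvs) \<Rightarrow> ('x \<Rightarrow> 'yz \<Rightarrow> 'xyz) \<Rightarrow> bool"
  where "triple_tensor_product Txy Tyz Tl Tr \<longleftrightarrow>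
    tensor_product Txy \<and> tensor_product Tyz \<and> tensor_product Tl \<and> tensor_product Tr \<and>
    (\<forall>x y z. Tl (Txy x y) z = Tr x (Tyz y z))"

text \<open>\<open>F = f \<otimes> g\<close>; by density of the span of pure tensors there is at most one such \<open>F\<close>.\<close>

definition is_tensor_map ::
    "('x \<Rightarrow> 'y \<Rightarrow> 'z::complex_tvs) \<Rightarrow> ('x' \<Rightarrow> 'y' \<Rightarrow> 'z'::complex_tvs)
      \<Rightarrow> ('x \<Rightarrow> 'x') \<Rightarrow> ('y \<Rightarrow> 'y') \<Rightarrow> ('z \<Rightarrow> 'z') \<Rightarrow> bool"
  where "is_tensor_map T T' f g F \<longleftrightarrow> cont_linear F \<and> (\<forall>x y. F (T x y) = T' (f x) (g y))"


section \<open>Hopf algebras and coactions\<close>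

text \<open>
  Deformation changes the product but not the underlying space, so the products are parameters and
  units are recovered from the products.
\<close>

definition is_unit_of :: "('a \<Rightarrow> 'a \<Rightarrow> 'a) \<Rightarrow> 'a \<Rightarrow> bool"
  where "is_unit_of mul e \<longleftrightarrow> (\<forall>x. mul e x = x \<and> mul x e = x)"

definition unit_of :: "('a \<Rightarrow> 'a \<Rightarrow> 'a) \<Rightarrow> 'a"
  where "unit_of mul = (THE e. is_unit_of mul e)"

definition algebra_product :: "('a::complex_tvs \<Rightarrow> 'a \<Rightarrow> 'a) \<Rightarrow> bool"
  where "algebra_product mul \<longleftrightarrow> cont_bilinear mul \<and>
    (\<forall>x y z. mul (mul x y) z = mul x (mul y z)) \<and> (\<exists>e. is_unit_of mul e)"

definition algebra_map :: "('a::complex_tvs \<Rightarrow> 'a \<Rightarrow> 'a) \<Rightarrow> ('b::complex_tvs \<Rightarrow> 'b \<Rightarrow> 'b) \<Rightarrow> ('a \<Rightarrow> 'b) \<Rightarrow> bool"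
  where "algebra_map mulA mulB f \<longleftrightarrow> cont_linear f \<and>
    (\<forall>x y. f (mulA x y) = mulB (f x) (f y)) \<and> f (unit_of mulA) = unit_of mulB"

text \<open>
  \<open>hopf_algebra mul hh hhl hhr \<Delta> \<epsilon>\<close>: the product \<open>mul\<close>, coproduct \<open>\<Delta>\<close> and counit \<open>\<epsilon>\<close> form a Hopf
  algebra, where \<open>hh\<close> is the tensor product \<open>H \<otimes> H\<close> and \<open>hhl\<close>, \<open>hhr\<close> the threefold one.  Here \<open>mulHH\<close>
  is the product of \<open>H \<otimes> H\<close>, \<open>Dl = \<Delta> \<otimes> id\<close>, \<open>Dr = id \<otimes> \<Delta>\<close>, \<open>El = \<epsilon> \<otimes> id\<close> and \<open>Er = id \<otimes> \<epsilon>\<close> (with values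
  in \<open>\<complex> \<otimes> H = H = H \<otimes> \<complex>\<close>), \<open>S\<close> is the antipode, \<open>Sl = S \<otimes> id\<close>, \<open>Sr = id \<otimes> S\<close>, and \<open>M\<close> is the product
  as a linear map on \<open>H \<otimes> H\<close>.
\<close>

definition hopf_algebra ::
    "('h::complex_tvs \<Rightarrow> 'h \<Rightarrow> 'h) \<Rightarrow> ('h \<Rightarrow> 'h \<Rightarrow> 'hh::complex_tvs)
      \<Rightarrow> ('hh \<Rightarrow> 'h \<Rightarrow> 'hhh::complex_tvs) \<Rightarrow> ('h \<Rightarrow> 'hh \<Rightarrow> 'hhh)
      \<Rightarrow> ('h \<Rightarrow> 'hh) \<Rightarrow> ('h \<Rightarrow> complex) \<Rightarrow> bool"
  where "hopf_algebra mul hh hhl hhr \<Delta> \<epsilon> \<longleftrightarrow>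
    triple_tensor_product hh hh hhl hhr \<and>
    algebra_product mul \<and>
    (\<exists>mulHH. algebra_product mulHH \<and>
      (\<forall>x y x' y'. mulHH (hh x y) (hh x' y') = hh (mul x x') (mul y y')) \<and>
      algebra_map mul mulHH \<Delta>) \<and>
    algebra_map mul (*) \<epsilon> \<and>
    (\<exists>Dl Dr. is_tensor_map hh hhl \<Delta> id Dl \<and> is_tensor_map hh hhr id \<Delta> Dr \<and> Dl \<circ> \<Delta> = Dr \<circ> \<Delta>) \<and>
    (\<exists>El Er. is_tensor_map hh (\<lambda>c x. c *\<^sub>C x) \<epsilon> id El \<and> is_tensor_map hh (\<lambda>x c. c *\<^sub>C x) id \<epsilon> Er \<and>
      El \<circ> \<Delta> = id \<and> Er \<circ> \<Delta> = id) \<and>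
    (\<exists>S Sl Sr M. cont_linear S \<and>
      is_tensor_map hh hh S id Sl \<and> is_tensor_map hh hh id S Sr \<and>
      cont_linear M \<and> (\<forall>x y. M (hh x y) = mul x y) \<and>
      (\<forall>x. M (Sl (\<Delta> x)) = \<epsilon> x *\<^sub>C unit_of mul) \<and> (\<forall>x. M (Sr (\<Delta> x)) = \<epsilon> x *\<^sub>C unit_of mul))"

text \<open>
  \<open>ha\<close> is the tensor product \<open>H \<otimes> A\<close>, and \<open>hal\<close>, \<open>har\<close> give \<open>H \<otimes> H \<otimes> A\<close> as \<open>(H \<otimes> H) \<otimes> A\<close> and
  \<open>H \<otimes> (H \<otimes> A)\<close>.  The product of \<open>H\<close> enters only through the product \<open>mulHA\<close> of \<open>H \<otimes> A\<close>.
\<close>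

definition coaction ::
    "('a::complex_tvs \<Rightarrow> 'a \<Rightarrow> 'a) \<Rightarrow> ('ha::complex_tvs \<Rightarrow> 'ha \<Rightarrow> 'ha)
      \<Rightarrow> ('h::complex_tvs \<Rightarrow> 'a \<Rightarrow> 'ha) \<Rightarrow> ('hh::complex_tvs \<Rightarrow> 'a \<Rightarrow> 'hha::complex_tvs)
      \<Rightarrow> ('h \<Rightarrow> 'ha \<Rightarrow> 'hha) \<Rightarrow> ('h \<Rightarrow> 'hh) \<Rightarrow> ('h \<Rightarrow> complex) \<Rightarrow> ('a \<Rightarrow> 'ha) \<Rightarrow> bool"
  where "coaction mulA mulHA ha hal har \<Delta> \<epsilon> \<rho> \<longleftrightarrow>
    algebra_map mulA mulHA \<rho> \<and>
    (\<exists>D R. is_tensor_map ha hal \<Delta> id D \<and> is_tensor_map ha har id \<rho> R \<and> D \<circ> \<rho> = R \<circ> \<rho>) \<and>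
    (\<exists>E. is_tensor_map ha (\<lambda>c x. c *\<^sub>C x) \<epsilon> id E \<and> E \<circ> \<rho> = id)"

definition coinvariants :: "('h \<Rightarrow> 'h \<Rightarrow> 'h) \<Rightarrow> ('h \<Rightarrow> 'a \<Rightarrow> 'ha) \<Rightarrow> ('a \<Rightarrow> 'ha) \<Rightarrow> 'a set"
  where "coinvariants mulH ha \<rho> = {a. \<rho> a = ha (unit_of mulH) a}"


section \<open>Torus actions and deformed products\<close>

text \<open>
  The torus is \<open>'v / lattice\<close> for a Euclidean space \<open>'v\<close> with its integer lattice.  For
  \<open>'v = real^'n\<close> this is \<open>\<real>\<^sup>n / \<int>\<^sup>n\<close>; for \<open>'v = real^'n \<times> real^'n\<close> it is the torus squared.
  Normalized Haar measure is Lebesgue measure on the unit cube \<open>cbox 0 One\<close>.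
\<close>

definition lattice :: "'v::euclidean_space set"
  where "lattice = {k. \<forall>b\<in>Basis. k \<bullet> b \<in> \<int>}"

text \<open>Vector-valued integrals over the torus are weak (Pettis) integrals.\<close>

definition has_torus_integral :: "('v::euclidean_space \<Rightarrow> 'a::complex_tvs) \<Rightarrow> 'a \<Rightarrow> bool"
  where "has_torus_integral f v \<longleftrightarrow> (\<forall>\<phi> :: 'a \<Rightarrow> complex. cont_linear \<phi> \<longrightarrow>
    set_integrable lborel (cbox 0 One) (\<lambda>t. \<phi> (f t)) \<and>
    \<phi> v = (LINT t:cbox 0 One|lborel. \<phi> (f t)))"

definition torus_integrable :: "('v::euclidean_space \<Rightarrow> 'a::complex_tvs) \<Rightarrow> bool"
  where "torus_integrable f \<longleftrightarrow> (\<exists>v. has_torus_integral f v)"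

definition torus_integral :: "('v::euclidean_space \<Rightarrow> 'a::complex_tvs) \<Rightarrow> 'a"
  where "torus_integral f = (THE v. has_torus_integral f v)"

definition torus_action :: "('v::euclidean_space \<Rightarrow> 'a::complex_talgebra_1 \<Rightarrow> 'a) \<Rightarrow> bool"
  where "torus_action \<alpha> \<longleftrightarrow>
    (\<forall>t. cont_linear (\<alpha> t) \<and> (\<forall>x y. \<alpha> t (x * y) = \<alpha> t x * \<alpha> t y) \<and> \<alpha> t 1 = 1) \<and>
    (\<forall>s t. \<alpha> (s + t) = \<alpha> s \<circ> \<alpha> t) \<and> (\<forall>k\<in>lattice. \<alpha> k = id)"

definition isotypic :: "('v::euclidean_space \<Rightarrow> 'a::complex_tvs \<Rightarrow> 'a) \<Rightarrow> 'a \<Rightarrow> 'v \<Rightarrow> 'a"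
  where "isotypic \<alpha> a n = torus_integral (\<lambda>t. cis (- (2 * pi * (t \<bullet> n))) *\<^sub>C \<alpha> t a)"

definition isotypic_decomposition :: "('v::euclidean_space \<Rightarrow> 'a::complex_tvs \<Rightarrow> 'a) \<Rightarrow> bool"
  where "isotypic_decomposition \<alpha> \<longleftrightarrow>
    (\<forall>a. \<forall>n\<in>lattice. torus_integrable (\<lambda>t. cis (- (2 * pi * (t \<bullet> n))) *\<^sub>C \<alpha> t a)) \<and>
    (\<forall>a. (isotypic \<alpha> a has_sum a) lattice)"

definition deformed_product ::
    "('v \<Rightarrow> 'v) \<Rightarrow> ('v::euclidean_space \<Rightarrow> 'a::complex_talgebra_1 \<Rightarrow> 'a) \<Rightarrow> 'a \<Rightarrow> 'a \<Rightarrow> 'a"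
  where "deformed_product \<theta> \<alpha> a b =
    (\<Sum>\<^sub>\<infinity>(n, m)\<in>lattice \<times> lattice. cis (pi * (n \<bullet> \<theta> m)) *\<^sub>C (isotypic \<alpha> a n * isotypic \<alpha> b m))"

text \<open>
  The deformation makes sense: elements have isotypic decompositions, the series defining the
  deformed product converges, and the deformed product is separately continuous, as the products of
  all topological algebras here are.  All but the first condition are automatic in the purely
  algebraic case.
\<close>

definition deformable ::
    "('v \<Rightarrow> 'v) \<Rightarrow> ('v::euclidean_space \<Rightarrow> 'a::complex_talgebra_1 \<Rightarrow> 'a) \<Rightarrow> bool"
  where "deformable \<theta> \<alpha> \<longleftrightarrow> isotypic_decomposition \<alpha> \<and>
    (\<forall>a b. (\<lambda>(n, m). cis (pi * (n \<bullet> \<theta> m)) *\<^sub>C (isotypic \<alpha> a n * isotypic \<alpha> b m))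
      summable_on (lattice \<times> lattice)) \<and>
    (\<forall>a. continuous_on UNIV (deformed_product \<theta> \<alpha> a)) \<and>
    (\<forall>b. continuous_on UNIV (\<lambda>a. deformed_product \<theta> \<alpha> a b))"

end

theory Submission
  imports Defs
begin

text \<open>
  The isotypic components are eigenvectors of the torus action, because the torus integral is
  invariant under translations; so the left-hand integral of the compatibility condition is
  \<open>\<rho> (a\<^sub>n) * \<rho> (b\<^sub>m)\<close>.  By Fubini the right-hand integrals are products of isotypic components, so the
  right-hand side is the deformed product of \<open>\<rho> (a\<^sub>n)\<close> and \<open>\<rho> (b\<^sub>m)\<close>.  The condition thus says that
  \<open>\<rho>\<close> is multiplicative on isotypic components, and linearity and continuity extend this to all
  elements.  The unit is invariant under the action and hence is also the unit of the deformed
  product; the remaining parts of the coaction and the coinvariants involve no product.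
\<close>

section \<open>Invariance of the torus integral under translations\<close>

lemma integrable_lborel_translate:
  fixes f :: "'v::euclidean_space \<Rightarrow> 'b::{banach, second_countable_topology}"
  assumes "integrable lborel f"
  shows "integrable lborel (\<lambda>x. f (c + x))" and "(LINT x|lborel. f (c + x)) = integral\<^sup>L lborel f"
proof -
  have meas: "(+) c \<in> measurable lborel borel"
    by simp
  have f: "f \<in> borel_measurable borel"
    using borel_measurable_integrable[OF assms] by simp
  show "integrable lborel (\<lambda>x. f (c + x))"
    using assms integrable_distr_eq[OF meas f] by (simp add: lborel_distr_plus)
  show "(LINT x|lborel. f (c + x)) = integral\<^sup>L lborel f"
    using integral_distr[OF meas f] by (simp add: lborel_distr_plus)
qed

text \<open>Coordinate hyperplanes are Lebesgue null, so faces and cuts of the cube may be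
  disregarded under the integral.\<close>

lemma AE_lborel_inner_neq:
  assumes "b \<in> Basis"
  shows "AE x in lborel. x \<bullet> b \<noteq> (c::real)"
proof -
  have "closed {x. x \<bullet> b = c}"
    by (intro closed_Collect_eq continuous_intros)
  then have "{x. x \<bullet> b = c} \<in> null_sets lborel"
    using negligible_standard_hyperplane[OF assms, of c]
    by (simp add: negligible_iff_null_sets null_sets_completion_iff borel_closed)
  then show ?thesis
    by (auto dest!: AE_not_in)
qed

text \<open>By periodicity only the fractional part of \<open>c\<close> counts. A shift by it
  rearranges two slabs of the cube up to lattice translations, and Lebesgue measure is translation
  invariant. Integrability is part of the conclusion because shifts along several basis vectors are
  applied in succession.\<close>

lemma torus_integral_shift_Basis:
  fixes g :: "'v::euclidean_space \<Rightarrow> 'b::{banach, second_countable_topology}"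
  assumes int: "set_integrable lborel (cbox 0 One) g"
    and periodic: "\<And>x k. k \<in> lattice \<Longrightarrow> g (x + k) = g x"
    and b: "b \<in> Basis"
  shows "set_integrable lborel (cbox 0 One) (\<lambda>x. g (x + c *\<^sub>R b)) \<and>
    (LINT x:cbox 0 One|lborel. g (x + c *\<^sub>R b)) = (LINT x:cbox 0 One|lborel. g x)"
proof -
  define d where "d = frac c"
  have d: "0 \<le> d" "d < 1"
    by (simp_all add: d_def frac_lt_1)
  have shift: "g (x + (r + of_int k) *\<^sub>R b) = g (x + r *\<^sub>R b)" for x r k
  proof -
    have "of_int k *\<^sub>R b \<in> lattice"
      using b by (auto simp: lattice_def inner_Basis)
    then show ?thesis
      using periodic[of "of_int k *\<^sub>R b" "x + r *\<^sub>R b"] by (simp add: scaleR_add_left add.assoc)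
  qed
  have c: "g (x + c *\<^sub>R b) = g (x + d *\<^sub>R b)" for x
    using shift[of x d "\<lfloor>c\<rfloor>"] by (simp add: d_def frac_def)
  define C where "C = cbox 0 (One::'v)"
  \<comment> \<open>The cube shifted by \<open>d *\<^sub>R b\<close> is cut at \<open>x \<bullet> b = 1\<close> and the overhang moved back by \<open>b\<close>.  The face
    \<open>x \<bullet> b = 0\<close> is left out so that \<open>T\<close> below agrees everywhere, not just almost everywhere, with
    the shifted integrand, whose measurability is not known in advance.\<close>
  define D1 D2 where "D1 = C \<inter> {x. x \<bullet> b \<ge> d}" and "D2 = C \<inter> {x. x \<bullet> b \<le> d} \<inter> {x. x \<bullet> b > 0}"
  define G1 G2 where "G1 = (\<lambda>x. indicator D1 x *\<^sub>R g x)" and "G2 = (\<lambda>x. indicator D2 x *\<^sub>R g x)"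
  have "closed D1" "closed (C \<inter> {x. x \<bullet> b \<le> d})" "open {x. x \<bullet> b > 0}"
    by (auto simp: D1_def C_def intro!: closed_Int closed_Collect_le open_Collect_less continuous_intros)
  then have D: "D1 \<in> sets lborel" "D2 \<in> sets lborel" "D1 \<subseteq> C" "D2 \<subseteq> C"
    by (auto simp: D1_def D2_def intro: borel_closed borel_open)
  have G: "integrable lborel G1" "integrable lborel G2"
    using set_integrable_subset[OF int] D unfolding G1_def G2_def C_def set_integrable_def by blast+
  \<comment> \<open>Off the null hyperplanes \<open>x \<bullet> b = d\<close> and
    \<open>x \<bullet> b = 0\<close> the sets \<open>D1\<close> and \<open>D2\<close> partition the
    cube.\<close>
  have "AE x in lborel. indicator C x *\<^sub>R g x = G1 x + G2 x"
    using AE_lborel_inner_neq[OF b, of d] AE_lborel_inner_neq[OF b, of 0]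
    by eventually_elim (use b in \<open>auto simp: G1_def G2_def D1_def D2_def C_def mem_box indicator_def\<close>)
  then have sum1: "(LINT x:cbox 0 One|lborel. g x) = integral\<^sup>L lborel G1 + integral\<^sup>L lborel G2"
    unfolding set_lebesgue_integral_def C_def[symmetric]
    using G int by (subst integral_cong_AE[where g="\<lambda>x. G1 x + G2 x"])
      (auto simp: set_integrable_def C_def dest: borel_measurable_integrable)
  define T where "T = (\<lambda>x. G1 (d *\<^sub>R b + x) + G2 ((d - 1) *\<^sub>R b + x))"
  have T: "integrable lborel T" "integral\<^sup>L lborel T = integral\<^sup>L lborel G1 + integral\<^sup>L lborel G2"
    unfolding T_def using G by (auto simp: integrable_lborel_translate)
  have inC: "x \<in> C \<longleftrightarrow> (0 \<le> x \<bullet> b \<and> x \<bullet> b \<le> 1) \<and> (\<forall>i\<in>Basis - {b}. 0 \<le> x \<bullet> i \<and> x \<bullet> i \<le> 1)" for x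
    using b by (auto simp: C_def mem_box)
  have inner: "(r *\<^sub>R b + x) \<bullet> b = r + x \<bullet> b" "i \<in> Basis - {b} \<Longrightarrow> (r *\<^sub>R b + x) \<bullet> i = x \<bullet> i" for r x i
    using b by (auto simp: inner_add_left inner_Basis)
  \<comment> \<open>Pulled back by their translations, \<open>D1\<close> and \<open>D2\<close>
    become the parts of \<open>C\<close> with \<open>x \<bullet> b \<le> 1 - d\<close> and
    \<open>x \<bullet> b > 1 - d\<close>, so at each point of \<open>C\<close> exactly one of the
    two indicators is 1.\<close>
  have "T x = indicator C x *\<^sub>R g (x + c *\<^sub>R b)" for x
  proof -
    have g: "g (d *\<^sub>R b + x) = g (x + c *\<^sub>R b)" "g ((d - 1) *\<^sub>R b + x) = g (x + c *\<^sub>R b)"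
      using c[of x] shift[of x d "-1"] by (simp_all add: add.commute)
    have "d *\<^sub>R b + x \<in> D1 \<longleftrightarrow> x \<in> C \<and> x \<bullet> b \<le> 1 - d"
      unfolding D1_def using d by (auto simp: inC inner)
    moreover have "(d - 1) *\<^sub>R b + x \<in> D2 \<longleftrightarrow> x \<in> C \<and> x \<bullet> b > 1 - d"
      unfolding D2_def using d by (auto simp: inC inner)
    ultimately show ?thesis
      by (auto simp: T_def G1_def G2_def g indicator_def)
  qed
  then have "T = (\<lambda>x. indicator C x *\<^sub>R g (x + c *\<^sub>R b))"
    by blast
  then show ?thesis
    using T sum1 unfolding set_integrable_def set_lebesgue_integral_def C_def by simp
qed

text \<open>The vector \<open>t\<close> is expanded in the basis and applied one coordinate at a
  time; each partially shifted function is still lattice periodic, so the one-coordinate case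
  applies again.\<close>

lemma torus_integral_shift:
  fixes g :: "'v::euclidean_space \<Rightarrow> 'b::{banach, second_countable_topology}"
  assumes int: "set_integrable lborel (cbox 0 One) g"
    and periodic: "\<And>x k. k \<in> lattice \<Longrightarrow> g (x + k) = g x"
  shows "(LINT x:cbox 0 One|lborel. g (x + t)) = (LINT x:cbox 0 One|lborel. g x)"
proof -
  have "finite B \<Longrightarrow> B \<subseteq> Basis \<Longrightarrow>
    set_integrable lborel (cbox 0 One) (\<lambda>x. g (x + (\<Sum>b\<in>B. (t \<bullet> b) *\<^sub>R b))) \<and>
    (LINT x:cbox 0 One|lborel. g (x + (\<Sum>b\<in>B. (t \<bullet> b) *\<^sub>R b))) = (LINT x:cbox 0 One|lborel. g x)" for B
  proof (induction B rule: finite_induct)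
    case empty
    then show ?case using int by simp
  next
    case (insert b B)
    let ?s = "\<Sum>b\<in>B. (t \<bullet> b) *\<^sub>R b"
    define h where "h = (\<lambda>x. g (x + ?s))"
    have "set_integrable lborel (cbox 0 One) (\<lambda>x. h (x + (t \<bullet> b) *\<^sub>R b)) \<and>
      (LINT x:cbox 0 One|lborel. h (x + (t \<bullet> b) *\<^sub>R b)) = (LINT x:cbox 0 One|lborel. h x)"
    proof (rule torus_integral_shift_Basis)
      show "h (x + k) = h x" if "k \<in> lattice" for x k
        using periodic[OF that, of "x + ?s"] by (simp add: h_def add_ac)
    qed (use insert in \<open>auto simp: h_def\<close>)
    then show ?case
      using insert by (simp add: h_def add.assoc)
  qed
  from this[of Basis] show ?thesis
    by (simp add: euclidean_representation)
qed

section \<open>Continuous linear maps and weak integrals\<close>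

lemma cont_linearD:
  assumes "cont_linear f"
  shows "f (x + y) = f x + f y" and "f (c *\<^sub>C x) = c *\<^sub>C f x" and "isCont f x"
  using assms by (auto simp: cont_linear_def continuous_on_eq_continuous_at)

lemma cont_linear_compose:
  "cont_linear f \<Longrightarrow> cont_linear g \<Longrightarrow> cont_linear (\<lambda>x. f (g x))"
  unfolding cont_linear_def by (auto intro: continuous_on_compose2)

lemma cont_linear_mult:
  fixes y :: "'a::complex_talgebra_1"
  shows "cont_linear (\<lambda>x. x * y)" and "cont_linear ((*) y)"
proof -
  have "isCont (\<lambda>x. x * y) z" "isCont ((*) y) z" for z
    using continuous_mult_left[where x=z and y=y] continuous_mult_right[where x=y and y=z]
    unfolding isCont_def
    by (simp_all only: tendsto_at_iff_tendsto_nhds[where g="\<lambda>x. x * y"] tendsto_at_iff_tendsto_nhds[where g="(*) y"])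
  then show "cont_linear (\<lambda>x. x * y)" "cont_linear ((*) y)"
    by (auto simp: cont_linear_def distrib_left distrib_right scaleC_mult_left scaleC_mult_right
        intro: continuous_at_imp_continuous_on)
qed

lemma cont_linear_has_sum:
  assumes "cont_linear f" "(g has_sum x) S"
  shows "((\<lambda>i. f (g i)) has_sum f x) S"
proof -
  have "((f \<circ> g) has_sum f x) S"
    using assms cont_linearD(1,3)[OF assms(1)]
    by (intro has_sum_comm_additive) (auto simp: Modules.additive_def isCont_def)
  then show ?thesis
    by (simp add: o_def)
qed

lemma scaleC_zero_right: "c *\<^sub>C (0::'a::complex_tvs) = 0"
  using scaleC_add_right[of c 0 "0::'a"] by simp

text \<open>Separation of points is applied to \<open>x - y\<close>. This turns identities between
  weak integrals or vector-valued sums into identities between complex numbers.\<close>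

lemma eq_if_functionals_eq:
  fixes x y :: "'a::complex_tvs"
  assumes "\<And>\<phi> :: 'a \<Rightarrow> complex. cont_linear \<phi> \<Longrightarrow> \<phi> x = \<phi> y"
  shows "x = y"
proof (rule ccontr)
  assume "x \<noteq> y"
  then obtain \<phi> :: "'a \<Rightarrow> complex" where \<phi>: "\<forall>y z. \<phi> (y + z) = \<phi> y + \<phi> z"
    "\<forall>c y. \<phi> (c *\<^sub>C y) = c * \<phi> y" "\<forall>y. (\<phi> \<longlongrightarrow> \<phi> y) (nhds y)" "\<phi> (x - y) \<noteq> 0"
    using dual_separates[of "x - y"] by auto
  then have "\<And>y. isCont \<phi> y"
    by (simp only: isCont_def tendsto_at_iff_tendsto_nhds)
  then have "cont_linear \<phi>"
    unfolding cont_linear_def scaleC_complex_def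
    using \<phi>(1,2) by (blast intro: continuous_at_imp_continuous_on)
  then have "\<phi> (x - y) + \<phi> y = \<phi> y"
    using \<phi>(1) assms[of \<phi>] by (metis diff_add_cancel)
  then show False
    using \<phi>(4) by simp
qed

lemma has_torus_integralD:
  fixes \<phi> :: "'a::complex_tvs \<Rightarrow> complex"
  assumes "has_torus_integral f v" "cont_linear \<phi>"
  shows "set_integrable lborel (cbox 0 One) (\<lambda>t. \<phi> (f t))" and "\<phi> v = (LINT t:cbox 0 One|lborel. \<phi> (f t))"
  using assms unfolding has_torus_integral_def by blast+

lemma has_torus_integral_unique:
  assumes "has_torus_integral f v" "has_torus_integral f w"
  shows "v = w"
  by (rule eq_if_functionals_eq) (rule trans[OF has_torus_integralD(2)[OF assms(1)]
      has_torus_integralD(2)[OF assms(2), symmetric]])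

lemma torus_integralI: "has_torus_integral f v \<Longrightarrow> torus_integral f = v"
  unfolding torus_integral_def by (blast intro: has_torus_integral_unique)

lemma has_torus_integral_torus_integral:
  "torus_integrable f \<Longrightarrow> has_torus_integral f (torus_integral f)"
  unfolding torus_integrable_def using torus_integralI by blast

text \<open>A functional composed with \<open>L\<close> is again a functional, so the claim is
  already contained in the definition of the weak integral. It is applied to the maps
  \<open>\<alpha> t\<close> and to multiplication by a fixed element.\<close>

lemma has_torus_integral_cont_linear:
  "has_torus_integral f v \<Longrightarrow> cont_linear L \<Longrightarrow> has_torus_integral (\<lambda>t. L (f t)) (L v)"
  unfolding has_torus_integral_def using cont_linear_compose by blast

lemma has_torus_integral_add:
  fixes f g :: "'v::euclidean_space \<Rightarrow> 'a::complex_tvs"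
  assumes "has_torus_integral f v" "has_torus_integral g w"
  shows "has_torus_integral (\<lambda>t. f t + g t) (v + w)"
  unfolding has_torus_integral_def
proof (intro allI impI)
  fix \<phi> :: "'a \<Rightarrow> complex"
  assume \<phi>: "cont_linear \<phi>"
  show "set_integrable lborel (cbox 0 One) (\<lambda>t. \<phi> (f t + g t)) \<and>
    \<phi> (v + w) = (LINT t:cbox 0 One|lborel. \<phi> (f t + g t))"
    unfolding cont_linearD(1)[OF \<phi>]
    using has_torus_integralD[OF assms(1) \<phi>] has_torus_integralD[OF assms(2) \<phi>]
    by (simp add: set_integral_add)
qed

text \<open>A functional turns the integrand into \<open>c t * \<phi> v\<close>, leaving only a
  scalar integral. It serves constant integrands, with \<open>c = 1\<close>, and the components of
  the unit, with \<open>c\<close> a character.\<close>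

lemma has_torus_integral_scaleC:
  fixes v :: "'a::complex_tvs"
  assumes "set_integrable lborel (cbox 0 One) c"
  shows "has_torus_integral (\<lambda>t. c t *\<^sub>C v) ((LINT t:cbox 0 One|lborel. c t) *\<^sub>C v)"
  unfolding has_torus_integral_def
proof (intro allI impI)
  fix \<phi> :: "'a \<Rightarrow> complex"
  assume \<phi>: "cont_linear \<phi>"
  show "set_integrable lborel (cbox 0 One) (\<lambda>t. \<phi> (c t *\<^sub>C v)) \<and>
    \<phi> ((LINT t:cbox 0 One|lborel. c t) *\<^sub>C v) = (LINT t:cbox 0 One|lborel. \<phi> (c t *\<^sub>C v))"
    unfolding cont_linearD(2)[OF \<phi>] scaleC_complex_def
    using assms by simp
qed

lemma torus_integral_const: "torus_integral (\<lambda>_ :: 'v::euclidean_space. v) = v"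
proof -
  have "set_integrable lborel (cbox 0 One :: 'v set) (\<lambda>_. 1::complex)"
    by (simp add: set_integrable_def)
  moreover have "(LINT t:(cbox 0 One :: 'v set)|lborel. 1 :: complex) = 1"
    by (simp add: set_lebesgue_integral_def scaleR_conv_of_real)
  ultimately show ?thesis
    using torus_integralI[OF has_torus_integral_scaleC[of "\<lambda>_::'v. 1" v]] by (simp add: scaleC_one)
qed

section \<open>Isotypic components\<close>

lemma zero_in_lattice: "0 \<in> lattice"
  by (simp add: lattice_def)

lemma lattice_prod: "lattice = lattice \<times> lattice"
  by (auto simp: lattice_def Basis_prod_def ball_Un)

lemma lattice_inner_Ints:
  assumes "k \<in> lattice" "n \<in> lattice"
  shows "k \<bullet> n \<in> \<int>"
  using assms by (subst euclidean_inner) (auto simp: lattice_def intro!: Ints_sum Ints_mult)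

lemma cis_lattice:
  assumes "k \<in> lattice" "n \<in> lattice"
  shows "cis (- (2 * pi * (k \<bullet> n))) = 1"
proof -
  obtain z where "k \<bullet> n = of_int z"
    using lattice_inner_Ints[OF assms] by (auto elim: Ints_cases)
  then show ?thesis
    by (simp flip: cis_inverse)
qed

lemma cis_split: "cis (- (2 * pi * ((s + t) \<bullet> n))) = cis (- (2 * pi * (s \<bullet> n))) * cis (- (2 * pi * (t \<bullet> n)))"
  by (simp add: cis_mult inner_add_left algebra_simps)

text \<open>For \<open>n \<noteq> 0\<close>, translation by a half period negates the character, so
  invariance makes the integral equal to its own negative.\<close>

lemma character_integral:
  fixes n :: "'v::euclidean_space"
  assumes "n \<in> lattice"
  shows "set_integrable lborel (cbox 0 One) (\<lambda>t. cis (- (2 * pi * (t \<bullet> n))))"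
    and "(LINT t:cbox 0 One|lborel. cis (- (2 * pi * (t \<bullet> n)))) = (if n = 0 then 1 else 0)"
proof -
  let ?\<chi> = "\<lambda>t. cis (- (2 * pi * (t \<bullet> n)))"
  show int: "set_integrable lborel (cbox 0 One) ?\<chi>"
    unfolding set_integrable_def by (intro borel_integrable_compact continuous_intros compact_cbox)
  show "(LINT t:cbox 0 One|lborel. ?\<chi> t) = (if n = 0 then 1 else 0)"
  proof (cases "n = 0")
    case True
    then show ?thesis
      by (simp add: set_lebesgue_integral_def scaleR_conv_of_real)
  next
    case False
    \<comment> \<open>Chosen so that \<open>t \<bullet> n = 1/2\<close>, where the character takes
      the value -1.\<close>
    define t where "t = n /\<^sub>R (2 * (n \<bullet> n))"
    have "?\<chi> (s + t) = - ?\<chi> s" for s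
      using False by (simp only: cis_split) (simp add: t_def flip: cis_inverse)
    moreover have "?\<chi> (s + k) = ?\<chi> s" if "k \<in> lattice" for s k
      by (simp only: cis_split cis_lattice[OF that assms] mult_1_right)
    ultimately have "- (LINT t:cbox 0 One|lborel. ?\<chi> t) = (LINT t:cbox 0 One|lborel. ?\<chi> t)"
      using torus_integral_shift[OF int, of t] by (simp add: set_lebesgue_integral_def)
    then show ?thesis
      using False by simp
  qed
qed

lemma has_torus_integral_isotypic:
  assumes "isotypic_decomposition \<alpha>" "n \<in> lattice"
  shows "has_torus_integral (\<lambda>t. cis (- (2 * pi * (t \<bullet> n))) *\<^sub>C \<alpha> t a) (isotypic \<alpha> a n)"
  using assms unfolding isotypic_decomposition_def isotypic_def
  by (intro has_torus_integral_torus_integral) auto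

lemma isotypic_has_sum: "isotypic_decomposition \<alpha> \<Longrightarrow> (isotypic \<alpha> a has_sum a) lattice"
  by (simp add: isotypic_decomposition_def)

lemma isotypic_add:
  assumes "isotypic_decomposition \<alpha>" "\<And>t. cont_linear (\<alpha> t)" "n \<in> lattice"
  shows "isotypic \<alpha> (a + b) n = isotypic \<alpha> a n + isotypic \<alpha> b n"
  unfolding isotypic_def[of _ "a + b"]
  using has_torus_integral_add[OF has_torus_integral_isotypic[OF assms(1,3), of a]
      has_torus_integral_isotypic[OF assms(1,3), of b]]
  by (intro torus_integralI) (simp add: cont_linearD(1)[OF assms(2)] scaleC_add_right)

text \<open>The orbit of \<open>1\<close> is constant, so each component is a character integral
  times \<open>1\<close>.\<close>

lemma isotypic_one:
  assumes "\<And>t. \<alpha> t 1 = (1::'a::complex_talgebra_1)" "n \<in> lattice"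
  shows "isotypic \<alpha> 1 n = (if n = 0 then 1 else 0)"
proof -
  have "isotypic \<alpha> 1 n = (if n = 0 then 1 else 0) *\<^sub>C 1"
    unfolding isotypic_def assms(1)
    using has_torus_integral_scaleC[OF character_integral(1)[OF assms(2)], of 1]
    by (intro torus_integralI) (simp add: character_integral(2)[OF assms(2)])
  moreover have "0 *\<^sub>C (1::'a) = 0"
    using scaleC_add_left[of 0 0 "1::'a"] by simp
  ultimately show ?thesis
    by (simp add: scaleC_one)
qed

text \<open>Applying \<open>\<alpha> t\<close> under the integral replaces
  \<open>\<alpha> s a\<close> by \<open>\<alpha> (s + t) a\<close>; translation invariance undoes
  this replacement and leaves only the phase.\<close>

lemma action_isotypic:
  fixes \<alpha> :: "'v::euclidean_space \<Rightarrow> 'a::complex_talgebra_1 \<Rightarrow> 'a"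
  assumes act: "torus_action \<alpha>" and dec: "isotypic_decomposition \<alpha>" and n: "n \<in> lattice"
  shows "\<alpha> t (isotypic \<alpha> a n) = cis (2 * pi * (t \<bullet> n)) *\<^sub>C isotypic \<alpha> a n"
proof (rule eq_if_functionals_eq)
  fix \<phi> :: "'a \<Rightarrow> complex"
  assume \<phi>: "cont_linear \<phi>"
  have lin: "cont_linear (\<alpha> t)" and add: "\<And>s. \<alpha> (s + t) a = \<alpha> t (\<alpha> s a)"
    and lat: "\<And>k. k \<in> lattice \<Longrightarrow> \<alpha> k = id" and comp: "\<And>s r. \<alpha> (s + r) = \<alpha> s \<circ> \<alpha> r"
    using act by (auto simp: torus_action_def add.commute[of _ t])
  define g where "g = (\<lambda>s. \<phi> (cis (- (2 * pi * (s \<bullet> n))) *\<^sub>C \<alpha> s a))"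
  have g: "set_integrable lborel (cbox 0 One) g" "\<phi> (isotypic \<alpha> a n) = (LINT s:cbox 0 One|lborel. g s)"
    using has_torus_integralD[OF has_torus_integral_isotypic[OF dec n, of a] \<phi>] unfolding g_def by auto
  have "g (s + k) = g s" if "k \<in> lattice" for s k
    unfolding g_def comp lat[OF that] cis_split cis_lattice[OF that n] by simp
  then have shift: "(LINT s:cbox 0 One|lborel. g (s + t)) = \<phi> (isotypic \<alpha> a n)"
    using torus_integral_shift[OF g(1)] g(2) by simp
  have "\<phi> (\<alpha> t (isotypic \<alpha> a n)) =
      (LINT s:cbox 0 One|lborel. \<phi> (\<alpha> t (cis (- (2 * pi * (s \<bullet> n))) *\<^sub>C \<alpha> s a)))"
    by (rule has_torus_integralD(2)[OF has_torus_integral_cont_linear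
          [OF has_torus_integral_isotypic[OF dec n] lin] \<phi>])
  also have "\<dots> = (LINT s:cbox 0 One|lborel. cis (2 * pi * (t \<bullet> n)) * g (s + t))"
  proof -
    \<comment> \<open>This identity rewrites the integrand as a constant phase times the translate
      \<open>g (s + t)\<close>.\<close>
    have "cis (2 * pi * (t \<bullet> n)) * (cis (- (2 * pi * ((s + t) \<bullet> n)))) = cis (- (2 * pi * (s \<bullet> n)))" for s
      by (simp add: cis_mult inner_add_left algebra_simps)
    then show ?thesis
      unfolding g_def add by (simp add: cont_linearD[OF \<phi>] cont_linearD[OF lin] scaleC_complex_def
          flip: mult.assoc)
  qed
  also have "\<dots> = \<phi> (cis (2 * pi * (t \<bullet> n)) *\<^sub>C isotypic \<alpha> a n)"
    using shift by (simp add: cont_linearD[OF \<phi>] scaleC_complex_def)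
  finally show "\<phi> (\<alpha> t (isotypic \<alpha> a n)) = \<phi> (cis (2 * pi * (t \<bullet> n)) *\<^sub>C isotypic \<alpha> a n)" .
qed

text \<open>Every functional sees an integrable scalar function on a product of two cubes, so Fubini
  applies. The inner integral is then evaluated through left multiplication by a fixed element, the
  outer one through right multiplication by a component of \<open>b\<close>.\<close>

lemma torus_integral_isotypic_mult:
  fixes \<gamma> :: "'v::euclidean_space \<Rightarrow> 'a::complex_talgebra_1 \<Rightarrow> 'a"
  assumes dec: "isotypic_decomposition \<gamma>" and nm: "n \<in> lattice" "m \<in> lattice"
    and int: "torus_integrable (\<lambda>(x, y). cis (- (2 * pi * (x \<bullet> n + y \<bullet> m))) *\<^sub>C (\<gamma> x a * \<gamma> y b))"
  shows "torus_integral (\<lambda>(x, y). cis (- (2 * pi * (x \<bullet> n + y \<bullet> m))) *\<^sub>C (\<gamma> x a * \<gamma> y b)) =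
    isotypic \<gamma> a n * isotypic \<gamma> b m"
proof (rule eq_if_functionals_eq)
  fix \<phi> :: "'a \<Rightarrow> complex"
  assume \<phi>: "cont_linear \<phi>"
  let ?f = "\<lambda>(x, y). cis (- (2 * pi * (x \<bullet> n + y \<bullet> m))) *\<^sub>C (\<gamma> x a * \<gamma> y b)"
  let ?A = "\<lambda>x. cis (- (2 * pi * (x \<bullet> n))) *\<^sub>C \<gamma> x a" and ?B = "\<lambda>y. cis (- (2 * pi * (y \<bullet> m))) *\<^sub>C \<gamma> y b"
  let ?C = "cbox 0 One :: 'v set"
  have f: "?f (x, y) = ?A x * ?B y" for x y
    by (simp add: scaleC_mult_left scaleC_mult_right scaleC_scaleC cis_mult algebra_simps)
  \<comment> \<open>This presents the unit cube of the doubled space as a product of unit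
    cubes.\<close>
  have "(One :: 'v \<times> 'v) = (One, One)"
  proof (rule euclidean_eqI)
    fix i :: "'v \<times> 'v"
    assume i: "i \<in> Basis"
    then have "(One, One) \<bullet> i = 1"
      by (auto simp: Basis_prod_def)
    with i show "One \<bullet> i = (One, One) \<bullet> i"
      by simp
  qed
  then have cube: "cbox 0 (One :: 'v \<times> 'v) = ?C \<times> ?C"
    by (simp add: zero_prod_def cbox_Pair_eq)
  have F: "set_integrable (lborel \<Otimes>\<^sub>M lborel) (?C \<times> ?C) (\<lambda>z. \<phi> (?f z))"
    "\<phi> (torus_integral ?f) = (LINT z:?C \<times> ?C|lborel \<Otimes>\<^sub>M lborel. \<phi> (?f z))"
    using has_torus_integralD[OF has_torus_integral_torus_integral[OF int] \<phi>]
    unfolding cube lborel_prod by blast+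
  have "\<phi> (torus_integral ?f) =
      (LINT x|lborel. LINT y|lborel. indicator (?C \<times> ?C) (x, y) *\<^sub>R \<phi> (?f (x, y)))"
    using F(2) lborel_pair.integral_fst'[OF F(1)[unfolded set_integrable_def]]
    by (simp add: set_lebesgue_integral_def)
  also have "\<dots> = (LINT x:?C|lborel. LINT y:?C|lborel. \<phi> (?A x * ?B y))"
    unfolding set_lebesgue_integral_def indicator_times f by (simp flip: scaleR_scaleR)
  also have "\<dots> = (LINT x:?C|lborel. \<phi> (?A x * isotypic \<gamma> b m))"
    by (simp only: has_torus_integralD(2)[OF has_torus_integral_cont_linear
          [OF has_torus_integral_isotypic[OF dec nm(2)] cont_linear_mult(2)] \<phi>])
  also have "\<dots> = \<phi> (isotypic \<gamma> a n * isotypic \<gamma> b m)"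
    by (rule has_torus_integralD(2)[OF has_torus_integral_cont_linear
          [OF has_torus_integral_isotypic[OF dec nm(1)] cont_linear_mult(1)] \<phi>, symmetric])
  finally show "\<phi> (torus_integral ?f) = \<phi> (isotypic \<gamma> a n * isotypic \<gamma> b m)" .
qed

section \<open>Deformed products\<close>

lemma unit_of_eq: "is_unit_of mul e \<Longrightarrow> unit_of mul = e"
  unfolding unit_of_def by (rule the_equality) (assumption, metis is_unit_of_def)

lemma unit_of_times: "unit_of ((*) :: 'a::ring_1 \<Rightarrow> 'a \<Rightarrow> 'a) = 1"
  by (rule unit_of_eq) (simp add: is_unit_of_def)

text \<open>As \<open>1\<close> has only a component of degree 0, the double series reduces to one
  slice. There the phase is 1 because one of its arguments vanishes, and the slice is the isotypic
  decomposition of \<open>a\<close>.\<close>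

lemma unit_of_deformed_product:
  fixes \<alpha> :: "'v::euclidean_space \<Rightarrow> 'a::complex_talgebra_1 \<Rightarrow> 'a"
  assumes dec: "isotypic_decomposition \<alpha>" and one: "\<And>t. \<alpha> t 1 = 1" and \<theta>: "\<theta> 0 = 0"
  shows "unit_of (deformed_product \<theta> \<alpha>) = 1"
proof (rule unit_of_eq, unfold is_unit_of_def, intro allI conjI)
  fix a :: 'a
  let ?L = "lattice :: 'v set"
  have "((\<lambda>(n, m). cis (pi * (n \<bullet> \<theta> m)) *\<^sub>C (isotypic \<alpha> 1 n * isotypic \<alpha> a m)) has_sum a) (Pair 0 ` ?L)"
    using isotypic_has_sum[OF dec, of a]
    by (subst has_sum_reindex) (auto simp: inj_on_def o_def isotypic_one[of \<alpha>, OF one] zero_in_lattice scaleC_one)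
  \<comment> \<open>Terms off the slice \<open>n = 0\<close> vanish, since the corresponding
    components of \<open>1\<close> do.\<close>
  then have "((\<lambda>(n, m). cis (pi * (n \<bullet> \<theta> m)) *\<^sub>C (isotypic \<alpha> 1 n * isotypic \<alpha> a m)) has_sum a) (?L \<times> ?L)"
    by (rule has_sum_cong_neutral[THEN iffD1, rotated -1])
      (auto simp: isotypic_one[of \<alpha>, OF one] zero_in_lattice image_iff scaleC_zero_right)
  then show "deformed_product \<theta> \<alpha> 1 a = a"
    unfolding deformed_product_def by (rule infsumI)
  have "((\<lambda>(n, m). cis (pi * (n \<bullet> \<theta> m)) *\<^sub>C (isotypic \<alpha> a n * isotypic \<alpha> 1 m)) has_sum a) ((\<lambda>n. (n, 0)) ` ?L)"
    using isotypic_has_sum[OF dec, of a]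
    by (subst has_sum_reindex) (auto simp: inj_on_def o_def isotypic_one[of \<alpha>, OF one] zero_in_lattice scaleC_one \<theta>)
  then have "((\<lambda>(n, m). cis (pi * (n \<bullet> \<theta> m)) *\<^sub>C (isotypic \<alpha> a n * isotypic \<alpha> 1 m)) has_sum a) (?L \<times> ?L)"
    by (rule has_sum_cong_neutral[THEN iffD1, rotated -1])
      (auto simp: isotypic_one[of \<alpha>, OF one] zero_in_lattice image_iff scaleC_zero_right)
  then show "deformed_product \<theta> \<alpha> a 1 = a"
    unfolding deformed_product_def by (rule infsumI)
qed

context
  fixes \<theta> :: "'v::euclidean_space \<Rightarrow> 'v" and \<alpha> :: "'v::euclidean_space \<Rightarrow> 'a::complex_talgebra_1 \<Rightarrow> 'a"
  assumes def: "deformable \<theta> \<alpha>" and lin: "\<And>t. cont_linear (\<alpha> t)"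
begin

lemma deformed_product_has_sum:
  "((\<lambda>(n, m). cis (pi * (n \<bullet> \<theta> m)) *\<^sub>C (isotypic \<alpha> a n * isotypic \<alpha> b m))
     has_sum deformed_product \<theta> \<alpha> a b) (lattice \<times> lattice)"
  using def unfolding deformable_def deformed_product_def by auto

text \<open>The defining series add termwise because isotypic components are additive. Combined with
  separate continuity, this lets the deformed product commute with convergent sums.\<close>

lemma deformed_product_add_left:
  "deformed_product \<theta> \<alpha> (a + a') b = deformed_product \<theta> \<alpha> a b + deformed_product \<theta> \<alpha> a' b"
proof -
  have "isotypic_decomposition \<alpha>"
    using def by (simp add: deformable_def)
  from isotypic_add[OF this lin] show ?thesis
    unfolding deformed_product_def[of _ _ "a + a'"]
    using has_sum_add[OF deformed_product_has_sum[of a b] deformed_product_has_sum[of a' b]]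
    by (intro infsumI)
      (auto elim!: has_sum_cong[THEN iffD1, rotated] simp: distrib_right scaleC_add_right)
qed

lemma deformed_product_add_right:
  "deformed_product \<theta> \<alpha> a (b + b') = deformed_product \<theta> \<alpha> a b + deformed_product \<theta> \<alpha> a b'"
proof -
  have "isotypic_decomposition \<alpha>"
    using def by (simp add: deformable_def)
  from isotypic_add[OF this lin] show ?thesis
    unfolding deformed_product_def[of _ _ _ "b + b'"]
    using has_sum_add[OF deformed_product_has_sum[of a b] deformed_product_has_sum[of a b']]
    by (intro infsumI)
      (auto elim!: has_sum_cong[THEN iffD1, rotated] simp: distrib_left scaleC_add_right)
qed

lemma has_sum_deformed_product_left:
  assumes "(f has_sum a) S"
  shows "((\<lambda>i. deformed_product \<theta> \<alpha> (f i) b) has_sum deformed_product \<theta> \<alpha> a b) S"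
proof -
  have "((\<lambda>a. deformed_product \<theta> \<alpha> a b) \<circ> f has_sum deformed_product \<theta> \<alpha> a b) S"
    using def assms by (intro has_sum_comm_additive)
      (auto simp: Modules.additive_def deformed_product_add_left deformable_def continuous_on_def)
  then show ?thesis
    by (simp add: o_def)
qed

lemma has_sum_deformed_product_right:
  assumes "(f has_sum b) S"
  shows "((\<lambda>i. deformed_product \<theta> \<alpha> a (f i)) has_sum deformed_product \<theta> \<alpha> a b) S"
proof -
  have "(deformed_product \<theta> \<alpha> a \<circ> f has_sum deformed_product \<theta> \<alpha> a b) S"
    using def assms by (intro has_sum_comm_additive)
      (auto simp: Modules.additive_def deformed_product_add_right deformable_def continuous_on_def)
  then show ?thesis
    by (simp add: o_def)
qed

end

text \<open>Functionals reduce iterating the double sum to complex numbers, because \<open>has_sum_SigmaD\<close> needs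
  a \<open>t3_space\<close>.\<close>

lemma deformed_product_hom:
  fixes \<alpha> :: "'v::euclidean_space \<Rightarrow> 'a::complex_talgebra_1 \<Rightarrow> 'a"
    and \<gamma> :: "'w::euclidean_space \<Rightarrow> 'b::complex_talgebra_1 \<Rightarrow> 'b"
  assumes def\<alpha>: "deformable \<theta> \<alpha>" and lin\<alpha>: "\<And>t. cont_linear (\<alpha> t)"
    and def\<gamma>: "deformable \<eta> \<gamma>" and lin\<gamma>: "\<And>t. cont_linear (\<gamma> t)"
    and \<rho>: "cont_linear \<rho>" "\<And>x y. \<rho> (x * y) = \<rho> x * \<rho> y"
    and components: "\<And>n m. n \<in> lattice \<Longrightarrow> m \<in> lattice \<Longrightarrow>
      cis (pi * (n \<bullet> \<theta> m)) *\<^sub>C (\<rho> (isotypic \<alpha> a n) * \<rho> (isotypic \<alpha> b m)) =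
      deformed_product \<eta> \<gamma> (\<rho> (isotypic \<alpha> a n)) (\<rho> (isotypic \<alpha> b m))"
  shows "\<rho> (deformed_product \<theta> \<alpha> a b) = deformed_product \<eta> \<gamma> (\<rho> a) (\<rho> b)"
proof (rule eq_if_functionals_eq)
  fix \<phi> :: "'b \<Rightarrow> complex"
  assume \<phi>: "cont_linear \<phi>"
  let ?P = "deformed_product \<eta> \<gamma>" and ?L = "lattice :: 'v set"
  have sum: "((\<lambda>n. \<rho> (isotypic \<alpha> x n)) has_sum \<rho> x) ?L" for x
    using def\<alpha> by (intro cont_linear_has_sum[OF \<rho>(1)] isotypic_has_sum) (simp add: deformable_def)
  have inner: "((\<lambda>m. \<phi> (?P x (\<rho> (isotypic \<alpha> b m)))) has_sum \<phi> (?P x (\<rho> b))) ?L" for x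
    by (rule cont_linear_has_sum[OF \<phi> has_sum_deformed_product_right[OF def\<gamma> lin\<gamma> sum]])
  \<comment> \<open>Both \<open>\<rho>\<close> and \<open>\<phi>\<close> pass through the series
    defining the product of \<open>a\<close> and \<open>b\<close>; \<open>components\<close> then
    turns each term into a deformed product in the target.\<close>
  have "((\<lambda>(n, m). \<phi> (?P (\<rho> (isotypic \<alpha> a n)) (\<rho> (isotypic \<alpha> b m))))
      has_sum \<phi> (\<rho> (deformed_product \<theta> \<alpha> a b))) (?L \<times> ?L)"
    using cont_linear_has_sum[OF cont_linear_compose[OF \<phi> \<rho>(1)]
        deformed_product_has_sum[OF def\<alpha> lin\<alpha>, of a b]]
    by (rule has_sum_cong[THEN iffD1, rotated]) (auto simp: cont_linearD[OF \<rho>(1)] \<rho>(2) components)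
  \<comment> \<open>For fixed \<open>n\<close> the sum over \<open>m\<close> is known from
    \<open>inner\<close>, so the double sum becomes an iterated one.\<close>
  then have "((\<lambda>n. \<phi> (?P (\<rho> (isotypic \<alpha> a n)) (\<rho> b))) has_sum \<phi> (\<rho> (deformed_product \<theta> \<alpha> a b))) ?L"
    by (rule has_sum_SigmaD[where f="\<lambda>(n, m). \<phi> (?P (\<rho> (isotypic \<alpha> a n)) (\<rho> (isotypic \<alpha> b m)))"])
      (simp only: prod.case inner)
  \<comment> \<open>Continuity in the left factor evaluates the same outer sum a second
    time.\<close>
  moreover have "((\<lambda>n. \<phi> (?P (\<rho> (isotypic \<alpha> a n)) (\<rho> b))) has_sum \<phi> (?P (\<rho> a) (\<rho> b))) ?L"
    by (rule cont_linear_has_sum[OF \<phi> has_sum_deformed_product_left[OF def\<gamma> lin\<gamma> sum]])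
  ultimately show "\<phi> (\<rho> (deformed_product \<theta> \<alpha> a b)) = \<phi> (?P (\<rho> a) (\<rho> b))"
    by (rule has_sum_unique)
qed

section \<open>Extension of the coaction and its coinvariants\<close>

theorem lemma5p3:
  fixes \<alpha> :: "real ^ 'n \<Rightarrow> 'a::complex_talgebra_1 \<Rightarrow> 'a"
    and \<beta> :: "real ^ 'n \<Rightarrow> 'h::complex_talgebra_1 \<Rightarrow> 'h"
    and \<theta> \<theta>' :: "real ^ 'n ^ 'n"
    and hh :: "'h \<Rightarrow> 'h \<Rightarrow> 'hh::complex_tvs"
    and hhl :: "'hh \<Rightarrow> 'h \<Rightarrow> 'hhh::complex_tvs" and hhr :: "'h \<Rightarrow> 'hh \<Rightarrow> 'hhh"
    and ha :: "'h \<Rightarrow> 'a \<Rightarrow> 'ha::complex_talgebra_1"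
    and hal :: "'hh \<Rightarrow> 'a \<Rightarrow> 'hha::complex_tvs" and har :: "'h \<Rightarrow> 'ha \<Rightarrow> 'hha"
    and \<gamma> :: "(real ^ 'n) \<times> (real ^ 'n) \<Rightarrow> 'ha \<Rightarrow> 'ha"
    and \<Delta> :: "'h \<Rightarrow> 'hh" and \<epsilon> :: "'h \<Rightarrow> complex" and \<rho> :: "'a \<Rightarrow> 'ha"
  assumes H: "hopf_algebra (*) hh hhl hhr \<Delta> \<epsilon>"
    and HA: "tensor_algebra ha"
    and HHA: "triple_tensor_product hh ha hal har"
    and actions: "torus_action \<alpha>" "torus_action \<beta>"
    and action_HA: "\<And>t' t. is_tensor_map ha ha (\<beta> t') (\<alpha> t) (\<gamma> (t', t))"
    and skew: "transpose \<theta> = - \<theta>" "transpose \<theta>' = - \<theta>'"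
    and deform_A: "deformable ((*v) \<theta>) \<alpha>"
    and deform_H: "deformable ((*v) \<theta>') \<beta>"
    and deform_HA: "deformable (map_prod ((*v) \<theta>') ((*v) \<theta>)) \<gamma>"
    and H_def: "hopf_algebra (deformed_product ((*v) \<theta>') \<beta>) hh hhl hhr \<Delta> \<epsilon>"
    and rho: "coaction (*) (*) ha hal har \<Delta> \<epsilon> \<rho>"
    and integrals_exist: "\<And>a b n m n' p m' q. {n, m, n', p, m', q} \<subseteq> lattice \<Longrightarrow>
      torus_integrable (\<lambda>((t', t), (s', s)).
        cis (- (2 * pi * (t' \<bullet> n' + t \<bullet> p + s' \<bullet> m' + s \<bullet> q))) *\<^sub>C
          (\<gamma> (t', t) (\<rho> (isotypic \<alpha> a n)) * \<gamma> (s', s) (\<rho> (isotypic \<alpha> b m))))"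
    and condition: "\<And>a b n m. n \<in> lattice \<Longrightarrow> m \<in> lattice \<Longrightarrow>
      cis (pi * (n \<bullet> (\<theta> *v m))) *\<^sub>C
        torus_integral (\<lambda>(t, s). cis (- (2 * pi * (t \<bullet> n + s \<bullet> m))) *\<^sub>C
          (\<rho> (\<alpha> t (isotypic \<alpha> a n)) * \<rho> (\<alpha> s (isotypic \<alpha> b m))))
      = (\<Sum>\<^sub>\<infinity>((n', p), (m', q)) \<in> (lattice \<times> lattice) \<times> (lattice \<times> lattice).
          cis (pi * (n' \<bullet> (\<theta>' *v m') + p \<bullet> (\<theta> *v q))) *\<^sub>C
          torus_integral (\<lambda>((t', t), (s', s)).
            cis (- (2 * pi * (t' \<bullet> n' + t \<bullet> p + s' \<bullet> m' + s \<bullet> q))) *\<^sub>C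
              (\<gamma> (t', t) (\<rho> (isotypic \<alpha> a n)) * \<gamma> (s', s) (\<rho> (isotypic \<alpha> b m)))))"
  shows "coaction (deformed_product ((*v) \<theta>) \<alpha>) (deformed_product (map_prod ((*v) \<theta>') ((*v) \<theta>)) \<gamma>)
           ha hal har \<Delta> \<epsilon> \<rho> \<and>
         coinvariants (deformed_product ((*v) \<theta>') \<beta>) ha \<rho> = coinvariants (*) ha \<rho>"
proof -
  let ?\<eta> = "map_prod ((*v) \<theta>') ((*v) \<theta>)"
  have \<rho>: "cont_linear \<rho>" "\<And>x y. \<rho> (x * y) = \<rho> x * \<rho> y" "\<rho> 1 = 1"
    using rho by (auto simp: coaction_def algebra_map_def unit_of_times)
  have lin_\<gamma>: "cont_linear (\<gamma> t)" for t
    using action_HA by (cases t) (auto simp: is_tensor_map_def)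
  have one_\<alpha>: "\<alpha> t 1 = 1" and one_\<beta>: "\<beta> t 1 = 1" and lin_\<alpha>: "cont_linear (\<alpha> t)" for t
    using actions by (auto simp: torus_action_def)
  \<comment> \<open>The unit of the tensor product is the pure tensor \<open>ha 1 1\<close>, on
    which \<open>\<gamma>\<close> acts factorwise.\<close>
  have one_\<gamma>: "\<gamma> t 1 = 1" for t
  proof (cases t)
    case (Pair t' s)
    have "1 = ha 1 1"
      using HA by (simp add: tensor_algebra_def)
    moreover have "\<gamma> (t', s) (ha 1 1) = ha (\<beta> t' 1) (\<alpha> s 1)"
      using action_HA[of t' s] by (simp add: is_tensor_map_def)
    ultimately show ?thesis
      by (simp add: Pair one_\<alpha> one_\<beta>)
  qed
  have dec: "isotypic_decomposition \<alpha>" "isotypic_decomposition \<beta>" "isotypic_decomposition \<gamma>"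
    using deform_A deform_H deform_HA by (simp_all add: deformable_def)
  have units: "unit_of (deformed_product ((*v) \<theta>) \<alpha>) = 1" "unit_of (deformed_product ((*v) \<theta>') \<beta>) = 1"
    "unit_of (deformed_product ?\<eta> \<gamma>) = 1"
    by (auto intro!: unit_of_deformed_product dec one_\<alpha> one_\<beta> one_\<gamma> simp: zero_prod_def)
  have lhs: "torus_integral (\<lambda>(t, s). cis (- (2 * pi * (t \<bullet> n + s \<bullet> m))) *\<^sub>C
      (\<rho> (\<alpha> t (isotypic \<alpha> a n)) * \<rho> (\<alpha> s (isotypic \<alpha> b m)))) =
      \<rho> (isotypic \<alpha> a n) * \<rho> (isotypic \<alpha> b m)"
    if nm: "n \<in> lattice" "m \<in> lattice" for a b n m
  proof -
    \<comment> \<open>The eigenvalues of the two components cancel the character, so the integrand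
      is constant.\<close>
    have "cis (- (2 * pi * (t \<bullet> n + s \<bullet> m))) *\<^sub>C
        (\<rho> (\<alpha> t (isotypic \<alpha> a n)) * \<rho> (\<alpha> s (isotypic \<alpha> b m))) =
        \<rho> (isotypic \<alpha> a n) * \<rho> (isotypic \<alpha> b m)" for t s
      unfolding action_isotypic[OF actions(1) dec(1) nm(1)] action_isotypic[OF actions(1) dec(1) nm(2)]
        cont_linearD(2)[OF \<rho>(1)]
      by (simp add: scaleC_mult_left scaleC_mult_right scaleC_scaleC cis_mult scaleC_one algebra_simps)
    then show ?thesis
      by (simp add: case_prod_unfold torus_integral_const)
  qed
  have rhs: "torus_integral (\<lambda>((t', t), (s', s)).
        cis (- (2 * pi * (t' \<bullet> n' + t \<bullet> p + s' \<bullet> m' + s \<bullet> q))) *\<^sub>C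
          (\<gamma> (t', t) (\<rho> (isotypic \<alpha> a n)) * \<gamma> (s', s) (\<rho> (isotypic \<alpha> b m)))) =
      isotypic \<gamma> (\<rho> (isotypic \<alpha> a n)) (n', p) * isotypic \<gamma> (\<rho> (isotypic \<alpha> b m)) (m', q)"
    if L: "{n, m, n', p, m', q} \<subseteq> lattice" for a b n m n' p m' q
  proof -
    \<comment> \<open>The four variables are regrouped into two points of the doubled torus, with
      degrees \<open>(n', p)\<close> and \<open>(m', q)\<close>.\<close>
    have eq: "(\<lambda>((t', t), (s', s)).
        cis (- (2 * pi * (t' \<bullet> n' + t \<bullet> p + s' \<bullet> m' + s \<bullet> q))) *\<^sub>C
          (\<gamma> (t', t) (\<rho> (isotypic \<alpha> a n)) * \<gamma> (s', s) (\<rho> (isotypic \<alpha> b m)))) =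
      (\<lambda>(x, y). cis (- (2 * pi * (x \<bullet> (n', p) + y \<bullet> (m', q)))) *\<^sub>C
          (\<gamma> x (\<rho> (isotypic \<alpha> a n)) * \<gamma> y (\<rho> (isotypic \<alpha> b m))))"
      by (auto simp: fun_eq_iff add.assoc)
    show ?thesis
      using integrals_exist[OF L, of a b] L unfolding eq
      by (intro torus_integral_isotypic_mult[OF dec(3)]) (auto simp: lattice_prod)
  qed
  have "\<rho> (deformed_product ((*v) \<theta>) \<alpha> a b) = deformed_product ?\<eta> \<gamma> (\<rho> a) (\<rho> b)" for a b
  proof (rule deformed_product_hom[OF deform_A lin_\<alpha> deform_HA lin_\<gamma> \<rho>(1,2)])
    fix n m :: "real ^ 'n"
    assume nm: "n \<in> lattice" "m \<in> lattice"
    \<comment> \<open>After rewriting with \<open>lhs\<close>, the hypothesis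
      \<open>condition\<close> has the left side of this goal, so only two series remain to be
      compared, term by term through \<open>rhs\<close>.\<close>
    show "cis (pi * (n \<bullet> (\<theta> *v m))) *\<^sub>C (\<rho> (isotypic \<alpha> a n) * \<rho> (isotypic \<alpha> b m)) =
        deformed_product ?\<eta> \<gamma> (\<rho> (isotypic \<alpha> a n)) (\<rho> (isotypic \<alpha> b m))"
      using condition[OF nm, of a b] unfolding lhs[OF nm]
      unfolding deformed_product_def lattice_prod
      by (elim trans, intro infsum_cong) (use nm in \<open>auto simp: rhs\<close>)
  qed
  then have "algebra_map (deformed_product ((*v) \<theta>) \<alpha>) (deformed_product ?\<eta> \<gamma>) \<rho>"
    using \<rho> by (simp add: algebra_map_def units)
  \<comment> \<open>The coinvariants see the product of \<open>H\<close> only through its unit,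
    which is \<open>1\<close> for both products.\<close>
  then show ?thesis
    using rho by (simp add: coaction_def coinvariants_def units unit_of_times)
qed

end
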